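(* Let $J$ be a multiplicative arithmetical function on the monic polynomials of $A=\mathbb{F}_q[X]$, and let $G$ be a completely multiplicative arithmetical function such that for every monic irreducible $P\in A$ one has $G(P)\neq 0$ and $G(P)\neq J(P)$. For monic $h\in A$ put $$F(h)=\sum_{g\mid h}G(g)\,J(h/g)\,\mu(h/g).$$ Then for all monic $h,h'\in A$, $$F(hh')=F(h)\,F(h')\,\frac{G((h,h'))}{F((h,h'))}.$$
   Context: $A=\mathbb{F}_q[X]$ is the polynomial ring over the finite field with $q=p^t$ elements, $p$ prime, $t\ge 1$. An arithmetical function is a complex-valued function on the set of monic polynomials in $A$. An arithmetical function $G$ is multiplicative if $G(1)=1$ and $G(fg)=G(f)G(g)$ for all coprime monic $f,g$; it is completely multiplicative if $G(1)=1$ and $G(fg)=G(f)G(g)$ for all monic $f,g$. The Möbius function $\mu$ is defined by $\mu(f)=0$ if $f$ is not squarefree and $\mu(f)=(-1)^k$ if $f$ is a nonzero constant times a product of $k$ distinct monic irreducibles (so $\mu(1)=1$). $(a,b)$ denotes the monic greatest common divisor, and sums over $g\mid n$ run over the monic divisors $g$ of $n$. *)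

theory Defs
  imports Complex_Main "HOL-Computational_Algebra.Computational_Algebra"
begin

(* The coefficient field is a type of sort {finite_field, field_gcd}. The class field_gcd does
   not restrict the field: on a field it only fixes the canonical division, normalization and gcd
   operations, which the library needs in order to provide gcd on the polynomial ring. With them,
   gcd f g is the monic greatest common divisor whenever f or g is nonzero
   (see monic_gcd_poly below). *)

abbreviation monic :: "'a :: {comm_semiring_1} poly \<Rightarrow> bool" where
  "monic f \<equiv> lead_coeff f = 1"

(* An arithmetical function is represented by a total function on polynomials, of which only the
   values at monic polynomials are ever constrained or used. *)

definition multiplicative_arith :: "('a :: field poly \<Rightarrow> complex) \<Rightarrow> bool" where
  "multiplicative_arith G \<longleftrightarrow>
     G 1 = 1 \<and> (\<forall>f g. monic f \<longrightarrow> monic g \<longrightarrow> coprime f g \<longrightarrow> G (f * g) = G f * G g)"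

definition completely_multiplicative_arith :: "('a :: field poly \<Rightarrow> complex) \<Rightarrow> bool" where
  "completely_multiplicative_arith G \<longleftrightarrow>
     G 1 = 1 \<and> (\<forall>f g. monic f \<longrightarrow> monic g \<longrightarrow> G (f * g) = G f * G g)"

(* For squarefree f the exponent is the number k in the factorization of f as a nonzero constant
   times k distinct monic irreducibles; see moebius_prod below. *)

definition moebius :: "'a :: field poly \<Rightarrow> complex" where
  "moebius f =
     (if squarefree f then (-1) ^ card {P. monic P \<and> irreducible P \<and> P dvd f} else 0)"

lemma monic_gcd_poly:
  fixes f g :: "'a :: field_gcd poly"
  assumes "f \<noteq> 0 \<or> g \<noteq> 0"
  shows "monic (gcd f g)"
proof -
  have nz: "gcd f g \<noteq> 0" using assms by auto
  have "unit_factor (gcd f g) = 1" using assms by (simp add: unit_factor_gcd)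
  then have "[:unit_factor (lead_coeff (gcd f g)):] = 1"
    by (simp add: unit_factor_poly_def)
  then have "unit_factor (lead_coeff (gcd f g)) = 1" by (simp add: one_pCons)
  moreover have "unit_factor (lead_coeff (gcd f g)) = lead_coeff (gcd f g)"
    by (rule is_unit_unit_factor) (use nz in \<open>simp add: dvd_field_iff\<close>)
  ultimately show ?thesis by simp
qed

lemma moebius_prod:
  fixes S :: "'a :: field_gcd poly set"
  assumes fin: "finite S" and S: "\<And>P. P \<in> S \<Longrightarrow> monic P \<and> irreducible P" and c: "c \<noteq> 0"
  shows "moebius (smult c (\<Prod>S)) = (-1) ^ card S"
proof -
  have assoc: "P = Q"
    if PQ: "monic P" "monic Q" "P dvd Q" "irreducible Q" "irreducible P"
    for P Q :: "'a poly"
  proof -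
    have "Q dvd P" using PQ irreducible_altdef by (metis irreducible_not_unit)
    then obtain u where u: "P = Q * u" by (elim dvdE)
    obtain v where v: "Q = P * v" using PQ(3) by (elim dvdE)
    have "Q = Q * (u * v)" using u v by (metis mult.assoc)
    moreover have "Q \<noteq> 0" using PQ(2) by auto
    ultimately have "u * v = 1" by auto
    then have "u dvd 1" by (metis dvdI)
    then obtain a where a: "u = [:a:]" by (auto simp: is_unit_poly_iff)
    have "lead_coeff P = lead_coeff Q * lead_coeff u" unfolding u by (rule lead_coeff_mult)
    then have "a = 1" using PQ(1,2) a by simp
    then show ?thesis using u a by simp
  qed
  have dvd_smult: "x dvd smult c f \<longleftrightarrow> x dvd f" for x f :: "'a poly"
    using c by (rule dvd_smult_iff)
  have sqf: "squarefree (\<Prod>S)"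
    using fin S
  proof (induction S rule: finite_induct)
    case empty
    show ?case by (auto simp: squarefree_def power2_eq_square intro: dvd_mult_left)
  next
    case (insert P T)
    have "squarefree P" using insert.prems[of P] by (simp add: irreducible_imp_prime_elem
        squarefree_prime_elem)
    moreover have "squarefree (\<Prod>T)" using insert by auto
    moreover have "coprime P (\<Prod>T)"
    proof (rule prod_coprime_right)
      fix Q assume "Q \<in> T"
      then have Q: "monic Q" "irreducible Q" "Q \<noteq> P" using insert by auto
      have P: "monic P" "irreducible P" using insert.prems by auto
      have "\<not> P dvd Q" using assoc[of P Q] P Q by auto
      then show "coprime P Q"
        using P(2) by (simp add: prime_elem_imp_coprime irreducible_imp_prime_elem)
    qed
    ultimately show ?case using insert.hyps by (simp add: squarefree_mult_coprime)
  qed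
  have "squarefree (smult c (\<Prod>S))" using sqf by (simp add: squarefree_def dvd_smult)
  moreover have "{P. monic P \<and> irreducible P \<and> P dvd smult c (\<Prod>S)} = S"
  proof (intro set_eqI iffI)
    fix P assume "P \<in> {P. monic P \<and> irreducible P \<and> P dvd smult c (\<Prod>S)}"
    then have P: "monic P" "irreducible P" "P dvd \<Prod>S" by (auto simp: dvd_smult)
    have "prime_elem P" using P(2) by (rule irreducible_imp_prime_elem)
    then obtain Q where "Q \<in> S" "P dvd Q"
      using P(3) prime_elem_dvd_prod_msetE[of P "mset_set S"] fin by (auto simp: prod_unfold_prod_mset)
    then show "P \<in> S" using assoc[of P Q] P S by auto
  next
    fix P assume "P \<in> S"
    then show "P \<in> {P. monic P \<and> irreducible P \<and> P dvd smult c (\<Prod>S)}"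
      using S fin by (auto simp: dvd_smult intro: dvd_prod_eqI)
  qed
  ultimately show ?thesis by (simp add: moebius_def)
qed

end

theory Submission
  imports Defs
begin

text \<open>
  The function \<open>F\<close> is the Dirichlet convolution of \<open>G\<close> with \<open>J \<mu>\<close>. Since \<open>\<mu>\<close> kills all divisors
  that are not squarefree and \<open>G\<close> is completely multiplicative, only the set of primes dividing
  \<open>h\<close> matters once the factor \<open>G h\<close> is split off: there is an Euler product
    \<open>F h = G h * (\<Prod>P | h. 1 - J P / G P)\<close>
  (lemma \<open>moebius_convolution_euler_product\<close>). It is built up one prime at a time from the two
  recursions \<open>F (P * h) = G P * F h\<close> if \<open>P | h\<close> (lemma \<open>moebius_convolution_prime_dvd\<close>), and
  \<open>F (P * h) = (G P - J P) * F h\<close> otherwise (lemma \<open>moebius_convolution_prime_not_dvd\<close>).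

  Write \<open>c S\<close> for the product of the factors \<open>1 - J P / G P\<close> over a finite set \<open>S\<close> of primes. The
  primes of \<open>h * h'\<close> form the union of those of \<open>h\<close> and of \<open>h'\<close>, and the primes of \<open>gcd h h'\<close>
  form the intersection, so
    \<open>c (S \<union> S') * c (S \<inter> S') = c S * c S'\<close>
  gives \<open>F (h * h') * F (gcd h h') = F h * F h' * G (gcd h h')\<close>. The hypotheses on \<open>G\<close> make
  \<open>F (gcd h h')\<close> nonzero, so one may divide by it.
\<close>

section \<open>Monic polynomials and primes\<close>

lemma monic_imp_nonzero: "monic f \<Longrightarrow> f \<noteq> (0 :: 'a :: field poly)"
  by auto

lemma monic_mult_iff:
  fixes f g :: "'a :: field poly"
  assumes "monic f"
  shows "monic (f * g) \<longleftrightarrow> monic g"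
  using assms by (simp add: lead_coeff_mult)

lemma monic_div:
  fixes f g :: "'a :: field poly"
  assumes "monic f" "monic g" "g dvd f"
  shows "monic (f div g)"
  using assms by (metis dvd_mult_div_cancel monic_mult_iff)

lemma normalize_monic:
  fixes f :: "'a :: field_gcd poly"
  assumes "monic f"
  shows "normalize f = f"
proof -
  have "unit_factor f = 1" using assms by (simp add: unit_factor_poly_def one_pCons)
  then show ?thesis using unit_factor_mult_normalize[of f] by simp
qed

lemma monic_unit:
  fixes u :: "'a :: field_gcd poly"
  assumes "monic u" "is_unit u"
  shows "u = 1"
  using normalize_monic[OF assms(1)] is_unit_normalize[OF assms(2)] by simp

lemma monic_normalize:
  fixes f :: "'a :: field_gcd poly"
  assumes "f \<noteq> 0"
  shows "monic (normalize f)"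
  using monic_gcd_poly[of f 0] assms by simp

lemma prime_poly_iff:
  fixes P :: "'a :: field_gcd poly"
  shows "prime P \<longleftrightarrow> monic P \<and> irreducible P"
proof
  assume "prime P"
  then show "monic P \<and> irreducible P"
    using monic_normalize[of P] by (auto simp: prime_elem_imp_irreducible)
next
  assume "monic P \<and> irreducible P"
  then show "prime P"
    by (auto intro!: primeI irreducible_imp_prime_elem normalize_monic)
qed

lemma monic_prime: "prime P \<Longrightarrow> monic (P :: 'a :: field_gcd poly)"
  by (simp add: prime_poly_iff)

lemma finite_monic_divisors:
  fixes h :: "'a :: {finite, field} poly"
  assumes "h \<noteq> 0"
  shows "finite {d. monic d \<and> d dvd h}"
proof (rule finite_subset)
  show "finite (Poly ` {xs :: 'a list. set xs \<subseteq> UNIV \<and> length xs \<le> Suc (degree h)})"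
    by (intro finite_imageI finite_lists_length_le) simp
  show "{d. monic d \<and> d dvd h} \<subseteq> Poly ` {xs. set xs \<subseteq> UNIV \<and> length xs \<le> Suc (degree h)}"
  proof
    fix d assume "d \<in> {d. monic d \<and> d dvd h}"
    then have "degree d \<le> degree h" "d \<noteq> 0" using assms by (auto intro: dvd_imp_degree_le)
    then have "length (coeffs d) \<le> Suc (degree h)" by (simp add: length_coeffs_degree)
    then show "d \<in> Poly ` {xs. set xs \<subseteq> UNIV \<and> length xs \<le> Suc (degree h)}"
      by (intro image_eqI[of _ _ "coeffs d"]) auto
  qed
qed

section \<open>Adjoining one prime\<close>

definition moebius_convolution ::
    "('a :: field poly \<Rightarrow> complex) \<Rightarrow> ('a poly \<Rightarrow> complex) \<Rightarrow> 'a poly \<Rightarrow> complex" where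
  "moebius_convolution G J h = (\<Sum>d | monic d \<and> d dvd h. G (h div d) * J d * moebius d)"

lemma moebius_prime_mult:
  fixes P d :: "'a :: field_gcd poly"
  assumes P: "prime P" and d: "d \<noteq> 0" "\<not> P dvd d"
  shows "moebius (P * d) = - moebius d"
proof (cases "squarefree d")
  case False
  then have "\<not> squarefree (P * d)" by (metis squarefree_multD(2))
  with False show ?thesis by (simp add: moebius_def)
next
  case True
  have "coprime P d" using P d by (simp add: prime_imp_coprime)
  then have sqf: "squarefree (P * d)"
    using True squarefree_prime[OF P] by (intro squarefree_mult_coprime)
  have "{Q. monic Q \<and> irreducible Q \<and> Q dvd f} = prime_factors f" if "f \<noteq> 0" for f :: "'a poly"
    using that by (auto simp: prime_factors_dvd prime_poly_iff)
  moreover have "prime_factors (P * d) = insert P (prime_factors d)"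
    using P d by (subst prime_factors_product) (auto simp: prime_prime_factors)
  moreover have "P \<notin> prime_factors d" using d by (auto simp: prime_factors_dvd)
  moreover have "P * d \<noteq> 0" using P d by auto
  ultimately show ?thesis using True sqf d by (simp add: moebius_def)
qed

text \<open>
  If \<open>P\<close> divides \<open>h\<close>, then \<open>h\<close> and \<open>P * h\<close> have the same prime factors, hence the same squarefree
  divisors.
\<close>

lemma squarefree_dvd_prime_mult:
  fixes P d h :: "'a :: field_gcd poly"
  assumes P: "prime P" "P dvd h" and d: "squarefree d" "d dvd P * h"
  shows "d dvd h"
proof (cases "P dvd d")
  case False
  then have "coprime d P" using P by (metis coprime_commute prime_imp_coprime)
  then show ?thesis using d(2) by (simp add: coprime_dvd_mult_right_iff)
next
  case True
  then obtain e where e: "d = P * e" by (elim dvdE)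
  have "\<not> P dvd e"
  proof
    assume "P dvd e"
    then have "P\<^sup>2 dvd d" unfolding e power2_eq_square by (rule mult_dvd_mono[OF dvd_refl])
    then show False using d(1) P(1) by (metis squarefreeD not_prime_unit)
  qed
  then have "coprime P e" using P(1) by (rule prime_imp_coprime[rotated])
  moreover have "e dvd h" using d(2) P(1) by (simp add: e)
  ultimately show ?thesis using P(2) by (simp add: e divides_mult)
qed

text \<open>
  The divisors of \<open>P * h\<close> that do not already divide \<open>h\<close> are not squarefree, so \<open>\<mu>\<close> removes them;
  in each remaining term the argument of \<open>G\<close> gains a factor \<open>P\<close>.
\<close>

lemma moebius_convolution_prime_dvd:
  fixes G J :: "'a :: {finite_field, field_gcd} poly \<Rightarrow> complex"
  assumes G: "completely_multiplicative_arith G" and P: "prime P" and h: "monic h" and "P dvd h"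
  shows "moebius_convolution G J (P * h) = G P * moebius_convolution G J h"
proof -
  have "P * h \<noteq> 0" using P h by auto
  then have "moebius_convolution G J (P * h) =
      (\<Sum>d | monic d \<and> d dvd h. G (P * h div d) * J d * moebius d)"
    unfolding moebius_convolution_def
    using squarefree_dvd_prime_mult[OF P \<open>P dvd h\<close>]
    by (intro sum.mono_neutral_right finite_monic_divisors) (auto simp: moebius_def)
  also have "\<dots> = (\<Sum>d | monic d \<and> d dvd h. G P * (G (h div d) * J d * moebius d))"
  proof (rule sum.cong[OF refl])
    fix d assume "d \<in> {d. monic d \<and> d dvd h}"
    then have d: "monic d" "d dvd h" by auto
    then have "G (P * h div d) = G P * G (h div d)"
      using G monic_prime[OF P] monic_div[OF h d]
      by (simp add: div_mult_swap[symmetric] completely_multiplicative_arith_def)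
    then show "G (P * h div d) * J d * moebius d = G P * (G (h div d) * J d * moebius d)" by simp
  qed
  finally show ?thesis by (simp add: moebius_convolution_def sum_distrib_left)
qed

text \<open>
  The monic divisors of \<open>P * h\<close> are the monic divisors \<open>d\<close> of \<open>h\<close> and the products \<open>P * d\<close>; passing
  from \<open>d\<close> to \<open>P * d\<close> multiplies \<open>J d * moebius d\<close> by \<open>- J P\<close>.
\<close>

lemma moebius_convolution_prime_not_dvd:
  fixes G J :: "'a :: {finite_field, field_gcd} poly \<Rightarrow> complex"
  assumes G: "completely_multiplicative_arith G" and J: "multiplicative_arith J"
    and P: "prime P" and h: "monic h" and nd: "\<not> P dvd h"
  shows "moebius_convolution G J (P * h) = (G P - J P) * moebius_convolution G J h"
proof -
  let ?D = "{d. monic d \<and> d dvd h}"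
  let ?t = "\<lambda>d. G (P * h div d) * J d * moebius d"
  have mP: "monic P" and P0: "P \<noteq> 0" using P by (auto simp: monic_prime)
  have fin: "finite ?D" using h by (intro finite_monic_divisors) auto
  have split: "{d. monic d \<and> d dvd P * h} = ?D \<union> (*) P ` ?D"
  proof (intro equalityI subsetI)
    fix d assume "d \<in> {d. monic d \<and> d dvd P * h}"
    then have d: "monic d" "d dvd P * h" by auto
    show "d \<in> ?D \<union> (*) P ` ?D"
    proof (cases "P dvd d")
      case True
      then obtain e where e: "d = P * e" by (elim dvdE)
      then show ?thesis using d P0 monic_mult_iff[OF mP, of e] by auto
    next
      case False
      then have "coprime d P" using P by (metis coprime_commute prime_imp_coprime)
      then show ?thesis using d by (simp add: coprime_dvd_mult_right_iff)
    qed
  next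
    fix d assume "d \<in> ?D \<union> (*) P ` ?D"
    then show "d \<in> {d. monic d \<and> d dvd P * h}" using monic_mult_iff[OF mP] by auto
  qed
  have disj: "?D \<inter> (*) P ` ?D = {}"
    using nd by (auto dest: dvd_mult_left)
  have old: "?t d = G P * (G (h div d) * J d * moebius d)" if "d \<in> ?D" for d
  proof -
    have "monic d" "d dvd h" using that by auto
    then show ?thesis
      using G mP monic_div[OF h]
      by (simp add: div_mult_swap[symmetric] completely_multiplicative_arith_def)
  qed
  have new: "?t (P * d) = - J P * (G (h div d) * J d * moebius d)" if "d \<in> ?D" for d
  proof -
    have d: "monic d" "d dvd h" using that by auto
    then have "\<not> P dvd d" using nd dvd_trans by blast
    moreover from this have "coprime P d" using P by (simp add: prime_imp_coprime)
    ultimately show ?thesis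
      using J mP d P0 monic_imp_nonzero[OF d(1)] moebius_prime_mult[OF P]
      by (simp add: multiplicative_arith_def)
  qed
  have "moebius_convolution G J (P * h) = sum ?t ?D + sum ?t ((*) P ` ?D)"
    unfolding moebius_convolution_def split using fin disj by (intro sum.union_disjoint) auto
  also have "sum ?t ((*) P ` ?D) = (\<Sum>d\<in>?D. ?t (P * d))"
    using P0 by (subst sum.reindex) (auto simp: inj_on_def)
  also have "\<dots> = - J P * moebius_convolution G J h"
    unfolding moebius_convolution_def sum_distrib_left by (rule sum.cong[OF refl new])
  also have "sum ?t ?D = G P * moebius_convolution G J h"
    unfolding moebius_convolution_def sum_distrib_left by (rule sum.cong[OF refl old])
  finally show ?thesis by (simp add: algebra_simps)
qed

section \<open>The Euler product and the multiplication formula\<close>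

lemma moebius_convolution_euler_product:
  fixes G J :: "'a :: {finite_field, field_gcd} poly \<Rightarrow> complex"
  assumes G: "completely_multiplicative_arith G" and J: "multiplicative_arith J"
    and G0: "\<And>P. prime P \<Longrightarrow> G P \<noteq> 0" and "monic h"
  shows "moebius_convolution G J h = G h * (\<Prod>P\<in>prime_factors h. 1 - J P / G P)"
  using \<open>monic h\<close>
proof (induction h rule: prime_divisors_induct)
  case zero
  then show ?case by simp
next
  case (unit u)
  then have "u = 1" by (simp add: monic_unit)
  moreover have "{d :: 'a poly. monic d \<and> d dvd 1} = {1}"
    by (auto intro: monic_unit)
  moreover have "moebius (1 :: 'a poly) = 1" using moebius_prod[of "{}" 1] by (simp add: one_pCons)
  ultimately show ?case
    using G J by (simp add: moebius_convolution_def completely_multiplicative_arith_def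
        multiplicative_arith_def)
next
  case (factor P h)
  have mP: "monic P" using factor.hyps by (rule monic_prime)
  then have mh: "monic h" using factor.prems by (simp add: monic_mult_iff)
  then have h0: "h \<noteq> 0" by auto
  have GP: "G (P * h) = G P * G h"
    using G mP mh by (simp add: completely_multiplicative_arith_def)
  have pf: "prime_factors (P * h) = insert P (prime_factors h)"
    using factor.hyps h0 by (subst prime_factors_product) (auto simp: prime_prime_factors)
  show ?case
  proof (cases "P dvd h")
    case True
    then have "P \<in> prime_factors h" using factor.hyps h0 by (simp add: prime_factors_dvd)
    then have "prime_factors (P * h) = prime_factors h" using pf by auto
    then show ?thesis
      using moebius_convolution_prime_dvd[OF G factor.hyps mh True] factor.IH[OF mh] GP by simp
  next
    case False
    then have "P \<notin> prime_factors h" by (auto simp: prime_factors_dvd)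
    then have prod: "(\<Prod>Q\<in>prime_factors (P * h). 1 - J Q / G Q) =
        (1 - J P / G P) * (\<Prod>Q\<in>prime_factors h. 1 - J Q / G Q)"
      unfolding pf by simp
    show ?thesis
      unfolding moebius_convolution_prime_not_dvd[OF G J factor.hyps mh False] factor.IH[OF mh]
        GP prod
      using G0[OF factor.hyps] by (simp add: field_simps)
  qed
qed

lemma completely_multiplicative_nonzero:
  fixes G :: "'a :: field_gcd poly \<Rightarrow> complex"
  assumes G: "completely_multiplicative_arith G" and G0: "\<And>P. prime P \<Longrightarrow> G P \<noteq> 0" and "monic h"
  shows "G h \<noteq> 0"
  using \<open>monic h\<close>
proof (induction h rule: prime_divisors_induct)
  case zero
  then show ?case by simp
next
  case (unit u)
  then have "u = 1" by (simp add: monic_unit)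
  then show ?case using G by (simp add: completely_multiplicative_arith_def)
next
  case (factor P h)
  have mP: "monic P" using factor.hyps by (rule monic_prime)
  then have "monic h" using factor.prems by (simp add: monic_mult_iff)
  then show ?case
    using G mP factor.IH G0[OF factor.hyps] by (simp add: completely_multiplicative_arith_def)
qed

theorem theorem2p3:
  fixes J G F :: "'a :: {finite_field, field_gcd} poly \<Rightarrow> complex"
  assumes "multiplicative_arith J"
    and "completely_multiplicative_arith G"
    and "\<And>P. monic P \<Longrightarrow> irreducible P \<Longrightarrow> G P \<noteq> 0 \<and> G P \<noteq> J P"
    and "\<And>h. monic h \<Longrightarrow>
           F h = (\<Sum>g | monic g \<and> g dvd h. G g * J (h div g) * moebius (h div g))"
  shows "\<forall>h h'. monic h \<longrightarrow> monic h' \<longrightarrow>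
           F (h * h') = F h * F h' * (G (gcd h h') / F (gcd h h'))"
proof (intro allI impI)
  fix h h' :: "'a poly"
  assume h: "monic h" and h': "monic h'"
  note J = assms(1) and G = assms(2)
  have G0: "G P \<noteq> 0" and GJ: "G P \<noteq> J P" if "prime P" for P
    using assms(3)[of P] that by (auto simp: prime_poly_iff)
  define c where "c = (\<lambda>S. \<Prod>P\<in>S. 1 - J P / G P)"
  have F: "F f = G f * c (prime_factors f)" if f: "monic f" for f
  proof -
    \<comment> \<open>The complementary divisor \<open>f div g\<close> turns the given sum into the convolution above.\<close>
    have "F f = moebius_convolution G J f"
      unfolding assms(4)[OF f] moebius_convolution_def
      using f monic_imp_nonzero[OF f] monic_div[OF f]
      by (intro sum.reindex_bij_witness[of _ "\<lambda>d. f div d" "\<lambda>d. f div d"])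
         (auto simp: div_div_eq_right div_dvd_iff_mult)
    then show ?thesis
      using moebius_convolution_euler_product[OF G J G0 f] by (simp add: c_def)
  qed
  have c0: "c (prime_factors f) \<noteq> 0" for f
    using G0 GJ by (auto simp: c_def in_prime_factors_iff) metis
  let ?g = "gcd h h'"
  have nz: "h \<noteq> 0" "h' \<noteq> 0" using h h' by auto
  then have g: "monic ?g" by (simp add: monic_gcd_poly)
  have hh': "monic (h * h')" using h h' by (simp add: monic_mult_iff)
  have "c (prime_factors (h * h')) * c (prime_factors ?g) = c (prime_factors h) * c (prime_factors h')"
    using nz by (simp add: c_def prime_factors_product prime_factors_gcd prod.union_inter
        del: prime_factorization_mult)
  moreover have "G (h * h') = G h * G h'"
    using G h h' by (simp add: completely_multiplicative_arith_def)
  moreover have "G ?g \<noteq> 0" by (rule completely_multiplicative_nonzero[OF G G0 g])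
  ultimately show "F (h * h') = F h * F h' * (G ?g / F ?g)"
    unfolding F[OF h] F[OF h'] F[OF g] F[OF hh'] using c0[of ?g] by (simp add: field_simps)
qed

end
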